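(* Let $c$ be a tetrahedron and let $m$ be the cardinality of $F(c)$ (for the first matrix below) or of $E(c)$ (for the second). Let $\mathbb K_{|c}$ be a symmetric positive definite matrix of order $3$. Let $\alpha=(\alpha_1,\dots,\alpha_{m-3})\in(\mathbb R^+)^{m-3}$ be any $(m-3)$-tuple of positive real numbers and let $\mathbb D_\alpha$ be the diagonal matrix with diagonal entries $\alpha_1,\dots,\alpha_{m-3}$. Let $w_{\mathcal F}$ and $w_{\mathcal E}$ be any two orthonormal bases of $\mathrm{im}(\mathbb F_{|c})^\perp$ and $\mathrm{im}(\mathbb E_{|c})^\perp$, respectively, and let $\mathbb W^{\mathcal F}_{|c}$ and $\mathbb W^{\mathcal E}_{|c}$ be the matrices whose columns are the vectors of the bases $w_{\mathcal F}$ and $w_{\mathcal E}$. Then the matrices $$\mathbb M^{\mathcal F}_{|c} := \frac{1}{|c|}\,\tilde{\mathbb E}_{|c}\,\mathbb K_{|c}\,\tilde{\mathbb E}_{|c}^T + \mathbb W^{\mathcal F}_{|c}\,\mathbb D_\alpha\,(\mathbb W^{\mathcal F}_{|c})^T, \qquad \mathbb M^{\mathcal E}_{|c} := \frac{1}{|c|}\,\tilde{\mathbb F}_{|c}\,\mathbb K_{|c}\,\tilde{\mathbb F}_{|c}^T + \mathbb W^{\mathcal E}_{|c}\,\mathbb D_\alpha\,(\mathbb W^{\mathcal E}_{|c})^T$$ are symmetric, consistent and positive definite.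
   Context: All vectors are column vectors in $\mathbb R^3$. $c$ is a nondegenerate tetrahedron with volume $|c|$, set of faces $F(c)$ and set of edges $E(c)$. Each edge and face of $c$ carries a fixed, arbitrarily chosen orientation. $\boldsymbol b_e,\boldsymbol b_f,\boldsymbol b_c$ denote the barycenters of the edge $e$, the face $f$, and $c$; write $\tilde{\boldsymbol n}_c=\boldsymbol b_c$ (the dual node). - Edge vector: $\boldsymbol e$ is the difference of the two endpoints of $e$, oriented as $e$. - Face vector: $\boldsymbol f=|f|\,\boldsymbol n_f$, with $|f|$ the area and $\boldsymbol n_f$ the unit normal to $f$ given by the orientation of $f$. - Restricted dual edge: $\tilde e_{f|c}$ is the segment joining $\tilde{\boldsymbol n}_c$ and $\boldsymbol b_f$; its vector is $\tilde{\boldsymbol e}_{f|c}=\pm(\boldsymbol b_f-\tilde{\boldsymbol n}_c)$, with the sign chosen so that $\tilde{\boldsymbol e}_{f|c}\cdot\boldsymbol f>0$. - Restricted dual face: $\tilde f_{e|c}$ is the plane quadrilateral with vertices $\tilde{\boldsymbol n}_c,\boldsymbol b_{f_i},\boldsymbol b_e,\boldsymbol b_{f_j}$, where $f_i,f_j$ are the two faces of $c$ with $e=f_i\cap f_j$. Its face vector is $\tilde{\boldsymbol f}_{e|c}=\tfrac12\big((\boldsymbol b_{f_i}-\tilde{\boldsymbol n}_c)\times(\boldsymbol b_e-\tilde{\boldsymbol n}_c)-(\boldsymbol b_{f_j}-\tilde{\boldsymbol n}_c)\times(\boldsymbol b_e-\tilde{\boldsymbol n}_c)\big)$, with $f_i,f_j$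 ordered so that $\tilde{\boldsymbol f}_{e|c}\cdot\boldsymbol e>0$. Matrices: fix orderings of $F(c)$ and $E(c)$. $\mathbb F_{|c}$ has rows $\boldsymbol f^T$ and $\tilde{\mathbb E}_{|c}$ has rows $\tilde{\boldsymbol e}_{f|c}^T$, $f\in F(c)$ (in the same order); $\mathbb E_{|c}$ has rows $\boldsymbol e^T$ and $\tilde{\mathbb F}_{|c}$ has rows $\tilde{\boldsymbol f}_{e|c}^T$, $e\in E(c)$ (in the same order). $\mathrm{im}$ denotes the image of the matrix as a linear map $\mathbb R^3\to\mathbb R^m$, and $\perp$ the orthogonal complement in $\mathbb R^m$. Consistency: $\mathbb M^{\mathcal F}_{|c}$ is consistent if $\tilde{\mathbb E}_{|c}\boldsymbol v=\mathbb M^{\mathcal F}_{|c}\,\mathbb F_{|c}\boldsymbol u$ for all $\boldsymbol u,\boldsymbol v\in\mathbb R^3$ with $\boldsymbol v=\mathbb K_{|c}\boldsymbol u$. $\mathbb M^{\mathcal E}_{|c}$ is consistent if $\tilde{\mathbb F}_{|c}\boldsymbol z=\mathbb M^{\mathcal E}_{|c}\,\mathbb E_{|c}\boldsymbol w$ for all $\boldsymbol w,\boldsymbol z\in\mathbb R^3$ with $\boldsymbol z=\mathbb K_{|c}\boldsymbol w$. *)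

theory Defs
  imports "HOL-Analysis.Analysis"
begin

section \<open>Matrices\<close>

definition symmetric_mat :: "real^'n^'n \<Rightarrow> bool" where
  "symmetric_mat A \<longleftrightarrow> transpose A = A"

text \<open>Symmetry is not part of this notion; it is always stated separately.\<close>

definition pos_definite :: "real^'n^'n \<Rightarrow> bool" where
  "pos_definite A \<longleftrightarrow> (\<forall>x. x \<noteq> 0 \<longrightarrow> x \<bullet> (A *v x) > 0)"

definition diag_mat :: "real^'k \<Rightarrow> real^'k^'k" where
  "diag_mat \<alpha> = (\<chi> i j. if i = j then \<alpha> $ i else 0)"

definition mat_of_columns :: "('k \<Rightarrow> real^'m) \<Rightarrow> real^'k^'m" where
  "mat_of_columns w = (\<chi> i j. w j $ i)"

definition orthonormal_basis_of :: "(real^'m) set \<Rightarrow> ('k \<Rightarrow> real^'m) \<Rightarrow> bool" where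
  "orthonormal_basis_of S w \<longleftrightarrow>
     (\<forall>i j. w i \<bullet> w j = (if i = j then 1 else 0)) \<and> span (range w) = S"

section \<open>Geometry of a tetrahedron\<close>

text \<open>
  A nondegenerate tetrahedron is a set \<open>c :: (real^3) set\<close> with \<open>3 simplex c\<close>. Its faces and
  edges are again subsets of \<open>real^3\<close>, and its volume is \<open>measure lebesgue c\<close>.
\<close>

definition faces :: "(real^3) set \<Rightarrow> (real^3) set set" where
  "faces c = {f. f facet_of c}"

definition edges :: "(real^3) set \<Rightarrow> (real^3) set set" where
  "edges c = {e. e edge_of c}"

text \<open>The barycenter of a simplex is the mean of its vertices, i.e. of its extreme points.\<close>

definition barycenter :: "(real^3) set \<Rightarrow> real^3" where
  "barycenter S = (1 / real (card {x. x extreme_point_of S})) *\<^sub>R (\<Sum>x | x extreme_point_of S. x)"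

text \<open>
  The area of a planar set is the two-dimensional Lebesgue measure of its preimage under an
  isometric embedding of \<open>real^2\<close> onto a plane containing it. Two such embeddings onto the
  same plane differ by a Euclidean motion of \<open>real^2\<close>, so the choice does not matter.
\<close>

definition planar_chart :: "(real^3) set \<Rightarrow> real^2 \<Rightarrow> real^3" where
  "planar_chart S = (SOME g. (\<forall>x y. dist (g x) (g y) = dist x y) \<and> S \<subseteq> range g)"

definition area :: "(real^3) set \<Rightarrow> real" where
  "area S = measure lebesgue (planar_chart S -` S)"

text \<open>
  An orientation of the edges picks, for each edge, one of the two orderings of its endpoints;
  an orientation of the faces picks, for each face, one of its two unit normals. The values
  outside \<open>edges c\<close> and \<open>faces c\<close> are irrelevant.
\<close>

definition edge_orientation :: "(real^3) set \<Rightarrow> ((real^3) set \<Rightarrow> (real^3) \<times> (real^3)) \<Rightarrow> bool" where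
  "edge_orientation c \<tau> \<longleftrightarrow> (\<forall>e\<in>edges c. e = closed_segment (fst (\<tau> e)) (snd (\<tau> e)))"

definition face_orientation :: "(real^3) set \<Rightarrow> ((real^3) set \<Rightarrow> real^3) \<Rightarrow> bool" where
  "face_orientation c \<nu> \<longleftrightarrow>
     (\<forall>f\<in>faces c. norm (\<nu> f) = 1 \<and> (\<forall>x\<in>f. \<forall>y\<in>f. \<nu> f \<bullet> (y - x) = 0))"

definition edge_vec :: "((real^3) set \<Rightarrow> (real^3) \<times> (real^3)) \<Rightarrow> (real^3) set \<Rightarrow> real^3" where
  "edge_vec \<tau> e = snd (\<tau> e) - fst (\<tau> e)"

definition face_vec :: "((real^3) set \<Rightarrow> real^3) \<Rightarrow> (real^3) set \<Rightarrow> real^3" where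
  "face_vec \<nu> f = area f *\<^sub>R \<nu> f"

text \<open>
  In the two definitions below the description determines a unique vector: exactly one of the two
  opposite candidates (in the second case, one for each ordering of the two faces meeting in \<open>e\<close>)
  has positive inner product with the primal vector.
\<close>

definition dual_edge_vec ::
    "(real^3) set \<Rightarrow> ((real^3) set \<Rightarrow> real^3) \<Rightarrow> (real^3) set \<Rightarrow> real^3" where
  "dual_edge_vec c \<nu> f =
     (THE v. (v = barycenter f - barycenter c \<or> v = - (barycenter f - barycenter c)) \<and>
             v \<bullet> face_vec \<nu> f > 0)"

definition dual_face_vec ::
    "(real^3) set \<Rightarrow> ((real^3) set \<Rightarrow> (real^3) \<times> (real^3)) \<Rightarrow> (real^3) set \<Rightarrow> real^3" where
  "dual_face_vec c \<tau> e =
     (THE v. (\<exists>fi\<in>faces c. \<exists>fj\<in>faces c. e = fi \<inter> fj \<and>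
                v = (1/2) *\<^sub>R
                  (cross3 (barycenter fi - barycenter c) (barycenter e - barycenter c)
                   - cross3 (barycenter fj - barycenter c) (barycenter e - barycenter c))) \<and>
             v \<bullet> edge_vec \<tau> e > 0)"

section \<open>The matrices attached to a tetrahedron\<close>

text \<open>
  Orderings of the faces and edges are bijections \<open>\<phi>\<close> and \<open>\<epsilon>\<close> from finite index types, which
  then have cardinality \<open>card (faces c)\<close> and \<open>card (edges c)\<close>.
\<close>

definition mat_of_rows :: "('m \<Rightarrow> real^3) \<Rightarrow> real^3^'m" where
  "mat_of_rows r = (\<chi> i. r i)"

definition face_mat :: "((real^3) set \<Rightarrow> real^3) \<Rightarrow> ('m \<Rightarrow> (real^3) set) \<Rightarrow> real^3^'m" where
  "face_mat \<nu> \<phi> = mat_of_rows (\<lambda>i. face_vec \<nu> (\<phi> i))"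

definition dual_edge_mat ::
    "(real^3) set \<Rightarrow> ((real^3) set \<Rightarrow> real^3) \<Rightarrow> ('m \<Rightarrow> (real^3) set) \<Rightarrow> real^3^'m" where
  "dual_edge_mat c \<nu> \<phi> = mat_of_rows (\<lambda>i. dual_edge_vec c \<nu> (\<phi> i))"

definition edge_mat ::
    "((real^3) set \<Rightarrow> (real^3) \<times> (real^3)) \<Rightarrow> ('m \<Rightarrow> (real^3) set) \<Rightarrow> real^3^'m" where
  "edge_mat \<tau> \<epsilon> = mat_of_rows (\<lambda>i. edge_vec \<tau> (\<epsilon> i))"

definition dual_face_mat ::
    "(real^3) set \<Rightarrow> ((real^3) set \<Rightarrow> (real^3) \<times> (real^3)) \<Rightarrow> ('m \<Rightarrow> (real^3) set) \<Rightarrow> real^3^'m" where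
  "dual_face_mat c \<tau> \<epsilon> = mat_of_rows (\<lambda>i. dual_face_vec c \<tau> (\<epsilon> i))"

text \<open>
  \<open>A\<close> is the primal matrix and \<open>B\<close> the dual one: \<open>face_mat\<close> and \<open>dual_edge_mat\<close>, or
  \<open>edge_mat\<close> and \<open>dual_face_mat\<close>.
\<close>

definition consistent :: "real^3^3 \<Rightarrow> real^3^'m \<Rightarrow> real^3^'m \<Rightarrow> real^'m^'m \<Rightarrow> bool" where
  "consistent K A B M \<longleftrightarrow> (\<forall>u v. v = K *v u \<longrightarrow> B *v v = M *v (A *v u))"

definition mass_mat ::
    "(real^3) set \<Rightarrow> real^3^3 \<Rightarrow> real^3^'m \<Rightarrow> real^'k^'m \<Rightarrow> real^'k \<Rightarrow> real^'m^'m" where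
  "mass_mat c K B W \<alpha> =
     (1 / measure lebesgue c) *\<^sub>R (B ** K ** transpose B) + W ** diag_mat \<alpha> ** transpose W"

end

theory Submission
  imports Defs
begin

text \<open>
  Write \<open>A\<close> for the primal and \<open>B\<close> for the dual matrix. Everything follows from the one identity
  \<open>B\<^sup>T A = |c| I\<close>. With \<open>W\<^sup>T A = 0\<close> it gives consistency. For definiteness, if the
  quadratic form of the matrix vanishes at \<open>x\<close>, then \<open>B\<^sup>T x = 0\<close> and \<open>W\<^sup>T x = 0\<close>; the latter
  puts \<open>x = A u\<close> in the image of \<open>A\<close>, and then \<open>|c| u = B\<^sup>T A u = 0\<close>.

  Each summand of \<open>B\<^sup>T A\<close>, a dual vector times a transposed primal vector, does not change when the
  primal orientation is reversed, since the dual vector changes sign too. So it can be computed from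
  a labelling of the vertices, with a sign that is the sign of their determinant. The labellings used
  for the four faces and for the six edges are even permutations of each other; hence all signs
  agree, and the identity becomes a polynomial identity in the vertices.
\<close>

section \<open>Linear algebra of the mass matrix\<close>

text \<open>This simp rule would turn \<open>transpose B *v x\<close> into \<open>x v* B\<close>;
  the proofs below keep the transposes visible.\<close>

declare transpose_matrix_vector [simp del]

lemma inner_mat_of_columns:
  "(transpose (mat_of_columns w) *v x) $ j = w j \<bullet> x"
  by (simp add: mat_of_columns_def transpose_def matrix_vector_mult_def inner_vec_def)

lemma inner_diag_mat: "y \<bullet> (diag_mat \<alpha> *v y) = (\<Sum>j\<in>UNIV. \<alpha> $ j * (y $ j)\<^sup>2)"
proof -
  have "(diag_mat \<alpha> *v y) $ j = \<alpha> $ j * y $ j" for j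
    by (simp add: diag_mat_def matrix_vector_mult_def if_distrib[of "\<lambda>z. z * _"] sum.delta cong: if_cong)
  then show ?thesis
    by (simp add: inner_vec_def power2_eq_square algebra_simps)
qed

lemma symmetric_mat_congruence:
  assumes "symmetric_mat K"
  shows "symmetric_mat (B ** K ** transpose B)"
  using assms by (simp add: symmetric_mat_def matrix_transpose_mul transpose_transpose matrix_mul_assoc)

lemma symmetric_diag_mat: "symmetric_mat (diag_mat \<alpha>)"
  by (simp add: symmetric_mat_def diag_mat_def transpose_def vec_eq_iff)

lemma inner_matrix_vector_mult: "x \<bullet> (B *v y) = (transpose B *v x) \<bullet> (y :: real^'n)"
  for B :: "real^'n^'m"
  by (simp add: dot_lmul_matrix transpose_matrix_vector)

lemma mass_mat_vector_mult:
  "mass_mat c K B W \<alpha> *v x =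
     (1 / measure lebesgue c) *\<^sub>R (B *v (K *v (transpose B *v x)))
       + W *v (diag_mat \<alpha> *v (transpose W *v x))"
proof -
  have "(1 / measure lebesgue c) *\<^sub>R (B ** K ** transpose B) *v x
      = (1 / measure lebesgue c) *\<^sub>R (B *v (K *v (transpose B *v x)))"
    by (simp add: scaleR_matrix_vector_assoc matrix_vector_mul_assoc matrix_mul_assoc)
  moreover have "(W ** diag_mat \<alpha> ** transpose W) *v x = W *v (diag_mat \<alpha> *v (transpose W *v x))"
    by (simp add: matrix_vector_mul_assoc matrix_mul_assoc)
  ultimately show ?thesis
    by (simp only: mass_mat_def matrix_vector_mult_add_rdistrib)
qed

lemma orthogonal_comp_rangeD:
  assumes "x \<in> orthogonal_comp (range f)"
  shows "x \<bullet> f u = 0"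
  using assms by (auto simp: orthogonal_comp_def orthogonal_def inner_commute)

lemma orthonormal_basis_in_span:
  "orthonormal_basis_of S w \<Longrightarrow> w j \<in> S"
  by (metis orthonormal_basis_of_def range_eqI span_superset subset_iff)

text \<open>Treats both matrices at once: \<open>A\<close> and \<open>B\<close> are instantiated
  with the face pair and with the edge pair, and all geometry enters through \<open>vol\<close> and
  \<open>BA\<close>.\<close>

lemma mass_mat_properties:
  fixes A B :: "real^3^'m::finite" and w :: "'k::finite \<Rightarrow> real^'m"
  assumes vol: "measure lebesgue c > 0"
    and BA: "\<And>u. transpose B *v (A *v u) = measure lebesgue c *\<^sub>R u"
    and K: "symmetric_mat K" "pos_definite K"
    and \<alpha>: "\<forall>j. \<alpha> $ j > 0"
    and w: "orthonormal_basis_of (orthogonal_comp (range (\<lambda>u. A *v u))) w"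
  defines "M \<equiv> mass_mat c K B (mat_of_columns w) \<alpha>"
  shows "symmetric_mat M \<and> consistent K A B M \<and> pos_definite M"
proof (intro conjI)
  let ?W = "mat_of_columns w"
  have add: "symmetric_mat (X + Y)" if "symmetric_mat X" "symmetric_mat Y" for X Y :: "real^'m^'m"
    using that by (simp add: symmetric_mat_def transpose_def vec_eq_iff)
  have scale: "symmetric_mat (r *\<^sub>R X)" if "symmetric_mat X" for X :: "real^'m^'m" and r
    using that by (simp add: symmetric_mat_def transpose_def vec_eq_iff)
  show "symmetric_mat M"
    unfolding M_def mass_mat_def
    by (intro add scale symmetric_mat_congruence symmetric_diag_mat K)
  have "w j \<bullet> (A *v u) = 0" for j u
    by (rule orthogonal_comp_rangeD[OF orthonormal_basis_in_span[OF w]])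
  then have WA: "transpose ?W *v (A *v u) = 0" for u
    by (simp add: vec_eq_iff inner_mat_of_columns)
  show "consistent K A B M"
    unfolding consistent_def M_def using vol
    by (simp add: mass_mat_vector_mult BA WA matrix_vector_mult_scaleR)
  show "pos_definite M"
    unfolding pos_definite_def
  proof (intro allI impI)
    fix x :: "real^'m"
    assume "x \<noteq> 0"
    let ?y = "transpose B *v x" and ?z = "transpose ?W *v x"
    have M: "x \<bullet> (M *v x) = (1 / measure lebesgue c) * (?y \<bullet> (K *v ?y))
          + (\<Sum>j\<in>UNIV. \<alpha> $ j * (?z $ j)\<^sup>2)"
      by (simp add: M_def mass_mat_vector_mult inner_right_distrib inner_matrix_vector_mult[of x]
          inner_diag_mat)
    have K0: "?y \<bullet> (K *v ?y) \<ge> 0"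
      using K(2) by (cases "?y = 0") (auto simp: pos_definite_def less_imp_le)
    have z0: "(\<Sum>j\<in>UNIV. \<alpha> $ j * (?z $ j)\<^sup>2) \<ge> 0"
      using \<alpha> by (intro sum_nonneg mult_nonneg_nonneg) (auto simp: less_imp_le)
    show "x \<bullet> (M *v x) > 0"
    proof (cases "?z = 0")
      case False
      then obtain j where "?z $ j \<noteq> 0"
        by (auto simp: vec_eq_iff)
      then have "(\<Sum>j\<in>UNIV. \<alpha> $ j * (?z $ j)\<^sup>2) > 0"
        using \<alpha> by (intro sum_pos2[of _ j]) (auto simp: less_imp_le)
      then show ?thesis
        using M K0 vol by (simp add: add_nonneg_pos)
    next
      case True
      have "w j \<bullet> x = 0" for j
        using True by (simp flip: inner_mat_of_columns)
      \<comment> \<open>The vectors orthogonal to \<open>x\<close> form a subspace; it contains the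
        basis \<open>w\<close>, hence all of its span, the complement of the image of
        \<open>A\<close>. So \<open>x\<close> lies in the double complement, which is the image
        itself.\<close>
      then have "range w \<subseteq> {y. orthogonal x y}"
        by (auto simp: orthogonal_def inner_commute)
      then have "orthogonal_comp (range (\<lambda>u. A *v u)) \<subseteq> {y. orthogonal x y}"
        using w span_minimal[OF _ subspace_orthogonal_to_vector]
        unfolding orthonormal_basis_of_def by metis
      then have "x \<in> orthogonal_comp (orthogonal_comp (range (\<lambda>u. A *v u)))"
        by (auto simp: orthogonal_comp_def orthogonal_commute)
      moreover have "subspace (range (\<lambda>u. A *v u))"
        by (simp add: linear_subspace_image)
      ultimately obtain u where u: "x = A *v u"
        by (auto simp: orthogonal_comp_self)
      with \<open>x \<noteq> 0\<close> have "u \<noteq> 0"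
        by auto
      then have "?y \<noteq> 0"
        using BA[of u] vol u by simp
      then have "?y \<bullet> (K *v ?y) > 0"
        using K(2) by (simp add: pos_definite_def)
      then show ?thesis
        using M z0 vol by (simp add: add_pos_nonneg)
    qed
  qed
qed

text \<open>Splits the product into one rank-one term per face or edge, so that orientations can be
  handled term by term.\<close>

lemma transpose_mat_of_rows_mult:
  "transpose (mat_of_rows s) *v (mat_of_rows r *v u) = (\<Sum>i\<in>UNIV. (r i \<bullet> u) *\<^sub>R s i)"
  by (simp add: mat_of_rows_def transpose_def matrix_vector_mult_def vec_eq_iff inner_vec_def mult.commute)

section \<open>Areas and volumes\<close>

text \<open>\<open>planar_chart\<close> is only known to preserve distances. Polarization turns this
  into preservation of inner products. The squared norm of the defect of additivity or homogeneity
  then expands into inner products of arguments, where the defect is zero.\<close>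

lemma isometry_linear_part:
  fixes g :: "'a::real_inner \<Rightarrow> 'b::real_inner"
  assumes iso: "\<And>x y. dist (g x) (g y) = dist x y"
  shows isometry_minus_origin_inner: "(g x - g 0) \<bullet> (g y - g 0) = x \<bullet> y"
    and isometry_minus_origin_linear: "linear (\<lambda>x. g x - g 0)"
proof -
  define L where "L x = g x - g 0" for x
  have norm_L: "norm (L x) = norm x" for x
    using iso[of x 0] by (simp add: L_def dist_norm)
  have norm_diff: "norm (L x - L y) = norm (x - y)" for x y
    using iso[of x y] by (simp add: L_def dist_norm)
  have inner_L: "L x \<bullet> L y = x \<bullet> y" for x y
    by (simp add: dot_norm_neg norm_L norm_diff)
  then show "(g x - g 0) \<bullet> (g y - g 0) = x \<bullet> y"
    by (simp add: L_def)
  have "L (x + y) - (L x + L y) = 0" for x y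
  proof -
    have "(L (x + y) - (L x + L y)) \<bullet> (L (x + y) - (L x + L y))
        = ((x + y) - (x + y)) \<bullet> ((x + y) - (x + y))"
      by (simp only: inner_diff_left inner_diff_right inner_add_left inner_add_right inner_L)
    then show ?thesis by simp
  qed
  moreover have "L (r *\<^sub>R x) - r *\<^sub>R L x = 0" for r x
  proof -
    have "(L (r *\<^sub>R x) - r *\<^sub>R L x) \<bullet> (L (r *\<^sub>R x) - r *\<^sub>R L x)
        = (r *\<^sub>R x - r *\<^sub>R x) \<bullet> (r *\<^sub>R x - r *\<^sub>R x)"
      by (simp only: inner_diff_left inner_diff_right inner_scaleR_left inner_scaleR_right inner_L
          right_diff_distrib)
    then show ?thesis by simp
  qed
  ultimately have "linear L"
    by (intro linearI) (metis eq_iff_diff_eq_0)+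
  then show "linear (\<lambda>x. g x - g 0)"
    by (simp add: L_def[abs_def])
qed

text \<open>An isometry is a linear map followed by a translation, so it commutes with convex hulls;
  being injective, its preimage undoes its image.\<close>

lemma isometry_vimage_convex_hull:
  fixes g :: "'a::real_inner \<Rightarrow> 'b::real_inner"
  assumes iso: "\<And>x y. dist (g x) (g y) = dist x y"
  shows "g -` (convex hull (g ` X)) = convex hull X"
proof -
  have g: "g = (\<lambda>x. g 0 + x) \<circ> (\<lambda>x. g x - g 0)"
    by auto
  have "convex hull (g ` X) = g ` (convex hull X)"
    by (subst (1 2) g)
      (simp only: image_comp[symmetric] convex_hull_translation
        convex_hull_linear_image[OF isometry_minus_origin_linear[OF iso]])
  moreover have "inj g"
    by (metis injI iso dist_eq_0_iff)
  ultimately show ?thesis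
    by (simp add: inj_vimage_image_eq)
qed

text \<open>The \<open>SOME\<close> in \<open>planar_chart\<close> needs a witness: a linear
  isometry of the plane onto the two-dimensional span of \<open>b - a\<close> and
  \<open>c - a\<close>, translated by \<open>a\<close>.\<close>

lemma planar_chart_triangle:
  assumes "\<not> affine_dependent {a, b, c}" "card {a, b, c} = 3"
  defines "g \<equiv> planar_chart (convex hull {a, b, c})"
  shows "dist (g x) (g y) = dist x y" and "convex hull {a, b, c} \<subseteq> range g"
proof -
  have dist: "b - a \<noteq> c - a" "a \<noteq> b" "a \<noteq> c"
    using assms(2) by (auto simp: card_insert_if split: if_splits)
  have "independent ((\<lambda>x. - a + x) ` ({a, b, c} - {a}))"
    using assms(1) affine_dependent_iff_dependent2[of a "{a, b, c}"] by simp
  moreover have "(\<lambda>x. - a + x) ` ({a, b, c} - {a}) = {b - a, c - a}"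
    using dist by auto
  ultimately have ind: "independent {b - a, c - a}"
    by simp
  have dim: "dim (UNIV :: (real^2) set) = dim (span {b - a, c - a})"
    using dim_eq_card_independent[OF ind] dist by (simp add: dim_UNIV)
  obtain h h' where h: "linear (h :: real^2 \<Rightarrow> real^3)" "h ` UNIV = span {b - a, c - a}"
    "\<And>x. norm (h x) = norm x"
    using isometries_subspaces[OF subspace_UNIV subspace_span dim] by (metis UNIV_I)
  define g0 where "g0 x = a + h x" for x
  have "dist (g0 x) (g0 y) = dist x y" for x y
    by (simp add: g0_def dist_norm h flip: linear_diff)
  moreover have "convex hull {a, b, c} \<subseteq> range g0"
  proof -
    have "g0 ` UNIV = (\<lambda>x. a + x) ` span {b - a, c - a}"
      by (simp add: g0_def[abs_def] flip: h(2) image_image)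
    then have "convex (range g0)" 
      by (simp add: convex_translation subspace_imp_convex)
    moreover have "{a, b, c} \<subseteq> range g0"
      unfolding \<open>g0 ` UNIV = _\<close> 
      by (auto simp: image_iff intro: bexI[of _ 0] bexI[of _ "b - a"] bexI[of _ "c - a"] span_base span_zero)
    ultimately show ?thesis
      by (simp add: hull_minimal)
  qed
  ultimately have "\<exists>g. (\<forall>x y. dist (g x) (g y) = dist (x :: real^2) y) \<and> convex hull {a, b, c} \<subseteq> range g"
    by blast
  from someI_ex[OF this]
  show "dist (g x) (g y) = dist x y" and "convex hull {a, b, c} \<subseteq> range g"
    unfolding g_def planar_chart_def by blast+
qed

lemma area_triangle:
  assumes "\<not> affine_dependent {a, b, c}" "card {a, b, c} = 3"
  shows "area (convex hull {a, b, c}) = norm (cross3 (b - a) (c - a)) / 2"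
proof -
  define g where "g = planar_chart (convex hull {a, b, c})"
  note iso = planar_chart_triangle(1)[OF assms, folded g_def]
  have "{a, b, c} \<subseteq> range g"
    unfolding g_def by (rule order_trans[OF hull_subset planar_chart_triangle(2)[OF assms]])
  then obtain A B C where abc: "a = g A" "b = g B" "c = g C"
    by (metis insert_subset imageE)
  \<comment> \<open>Moves the preservation of inner products from the base point 0 to an arbitrary
    base point.\<close>
  have diff: "(g x - g z) \<bullet> (g y - g z) = (x - z) \<bullet> (y - z)" for x y z
    using isometry_minus_origin_inner[OF iso, of x y] isometry_minus_origin_inner[OF iso, of x z]
      isometry_minus_origin_inner[OF iso, of z y] isometry_minus_origin_inner[OF iso, of z z]
    by (simp add: inner_diff_left inner_diff_right)
  define P Q where "P = B - A" and "Q = C - A"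
  have "area (convex hull {a, b, c}) = measure lebesgue (convex hull {A, B, C})"
    using isometry_vimage_convex_hull[OF iso, of "{A, B, C}"]
    by (simp add: area_def abc g_def[unfolded abc, symmetric])
  also have "\<dots> = measure lborel (convex hull {A, B, C})"
    by (intro measure_completion) (auto intro!: borel_closed compact_imp_closed finite_imp_compact_convex_hull)
  also have "\<dots> = \<bar>P $ 1 * Q $ 2 - P $ 2 * Q $ 1\<bar> / 2"
    by (simp add: content_triangle P_def Q_def abs_minus_commute mult.commute)
  \<comment> \<open>Both squares equal the Gram determinant of two sides of the triangle, which the
    chart preserves.\<close>
  also have "\<bar>P $ 1 * Q $ 2 - P $ 2 * Q $ 1\<bar> = norm (cross3 (b - a) (c - a))"
  proof (rule power2_eq_imp_eq)
    have "(norm (cross3 (b - a) (c - a)))\<^sup>2 = (P \<bullet> P) * (Q \<bullet> Q) - (P \<bullet> Q)\<^sup>2"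
      unfolding norm_cross by (simp add: power2_norm_eq_inner abc diff P_def Q_def)
    also have "\<dots> = (P $ 1 * Q $ 2 - P $ 2 * Q $ 1)\<^sup>2"
      by (simp add: inner_vec_def sum_2) algebra
    finally show "\<bar>P $ 1 * Q $ 2 - P $ 2 * Q $ 1\<bar>\<^sup>2 = (norm (cross3 (b - a) (c - a)))\<^sup>2"
      by simp
  qed auto
  finally show ?thesis .
qed

text \<open>Six times the signed volume; the sign records the orientation of the labelling.\<close>

definition tetra_det :: "real^3 \<Rightarrow> real^3 \<Rightarrow> real^3 \<Rightarrow> real^3 \<Rightarrow> real" where
  "tetra_det a b c d = (b - a) \<bullet> cross3 (c - a) (d - a)"

lemma volume_tetrahedron:
  assumes "card {a, b, c, d} = 4"
  shows "measure lebesgue (convex hull {a, b, c, d}) = \<bar>tetra_det a b c d\<bar> / 6"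
proof -
  have dist: "a \<noteq> b" "a \<noteq> c" "a \<noteq> d" "b \<noteq> c" "b \<noteq> d" "c \<noteq> d"
    using assms by (auto simp: card_insert_if split: if_splits)
  \<comment> \<open>\<open>content_simplex\<close> expects the vertices other than the base point
    \<open>a\<close> to be indexed by the coordinate type.\<close>
  define f :: "3 \<Rightarrow> real^3" where "f i = (if i = 1 then b else if i = 2 then c else d)" for i
  have f: "f 1 = b" "f 2 = c" "f 3 = d"
    by (simp_all add: f_def)
  have "range f = {b, c, d}"
    by (simp add: UNIV_3 f)
  moreover have "{a, b, c, d} - {a} = {b, c, d}"
    using dist by auto
  moreover have "inj f"
    by (rule eq_card_imp_inj_on) (simp_all add: \<open>range f = {b, c, d}\<close> dist)
  ultimately have bij: "bij_betw f UNIV ({a, b, c, d} - {a})"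
    by (simp add: bij_betw_def)
  have "measure lebesgue (convex hull {a, b, c, d}) = measure lborel (convex hull {a, b, c, d})"
    by (intro measure_completion) (auto intro!: borel_closed compact_imp_closed finite_imp_compact_convex_hull)
  also have "\<dots> = \<bar>det (\<chi> i. \<chi> j. f j $ i - a $ i)\<bar> / fact CARD(3)"
    by (rule content_simplex[OF _ _ _ bij]) (use assms in auto)
  also have "det (\<chi> i. \<chi> j. f j $ i - a $ i) = tetra_det a b c d"
    by (simp add: tetra_det_def f cross3_def inner_vec_def sum_3 det_3 algebra_simps)
  finally show ?thesis
    by (simp add: fact_numeral)
qed

text \<open>Four affinely independent points in space have a hull with nonempty interior, and such a
  convex set is not negligible.\<close>

lemma volume_tetrahedron_pos:
  assumes "\<not> affine_dependent {a, b, c, d :: real^3}" "card {a, b, c, d} = 4"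
  shows "measure lebesgue (convex hull {a, b, c, d}) > 0"
proof -
  let ?c = "convex hull {a, b, c, d}"
  have "interior ?c \<noteq> {}"
    using interior_convex_hull_eq_empty[of "{a, b, c, d}"] assms by simp
  then have "\<not> negligible ?c"
    by (simp add: negligible_convex_interior)
  moreover have "?c \<in> lmeasurable"
    by (simp add: lmeasurable_compact finite_imp_compact_convex_hull)
  ultimately show ?thesis
    by (metis negligible_iff_measure measure_nonneg less_le)
qed

section \<open>Barycenters, unit normals and the choice of sign\<close>

lemma barycenter_simplex:
  assumes "\<not> affine_dependent V"
  shows "barycenter (convex hull V) = (1 / real (card V)) *\<^sub>R (\<Sum>x\<in>V. x)"
  using assms by (simp add: barycenter_def extreme_point_of_convex_hull_affine_independent)

text \<open>The double cross product vanishes, which is the equality case of Cauchy-Schwarz: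
  \<open>cross3 x y\<close> is a multiple of \<open>n\<close>, with factor plus or minus its
  norm.\<close>

lemma unit_normal_cross3:
  assumes "norm n = 1" "n \<bullet> x = 0" "n \<bullet> y = 0"
  shows "norm (cross3 x y) *\<^sub>R n = cross3 x y \<or> norm (cross3 x y) *\<^sub>R n = - cross3 x y"
proof -
  let ?N = "cross3 x y"
  have "cross3 n ?N = 0"
    using assms by (simp add: Lagrange)
  then have eq: "(norm ?N)\<^sup>2 = (n \<bullet> ?N)\<^sup>2"
    using norm_cross[of n ?N] assms(1) by simp
  have "(?N - (n \<bullet> ?N) *\<^sub>R n) \<bullet> (?N - (n \<bullet> ?N) *\<^sub>R n) = (norm ?N)\<^sup>2 - (n \<bullet> ?N)\<^sup>2"
    using assms(1)
    unfolding power2_norm_eq_inner norm_eq_1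
    by (simp add: inner_diff_left inner_diff_right inner_commute power2_eq_square)
  then have "?N = (n \<bullet> ?N) *\<^sub>R n"
    using eq by simp
  moreover have "n \<bullet> ?N = norm ?N \<or> n \<bullet> ?N = - norm ?N"
    using eq by (simp add: power2_eq_iff) argo
  ultimately show ?thesis
    by (metis minus_minus scaleR_minus_left)
qed

text \<open>Here the orientation disappears: replacing \<open>F\<close> by \<open>- F\<close> flips
  both the coefficient and the chosen vector. The condition \<open>p \<bullet> N \<noteq> 0\<close>
  makes exactly one of the two candidates admissible.\<close>

lemma scaleR_the_positive_choice:
  assumes "F = N \<or> F = - N" and "p \<bullet> N \<noteq> 0"
  shows "(F \<bullet> u) *\<^sub>R (THE v. (v = p \<or> v = - p) \<and> v \<bullet> F > 0) = (sgn (p \<bullet> N) * (N \<bullet> u)) *\<^sub>R p"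
proof -
  have "(THE v. (v = p \<or> v = - p) \<and> v \<bullet> F > 0) = (if p \<bullet> F > 0 then p else - p)"
    using assms by (intro the_equality) auto
  then show ?thesis
    using assms by (auto simp: sgn_if)
qed

section \<open>The identity for faces and edges\<close>

lemma tetra_det_nonzero:
  assumes "\<not> affine_dependent {a, b, c, d}" "card {a, b, c, d} = 4"
  shows "tetra_det a b c d \<noteq> 0"
  using volume_tetrahedron_pos[OF assms] volume_tetrahedron[OF assms(2)] by auto

lemma card_4_distinct:
  "card {a, b, c, d} = 4 \<Longrightarrow> distinct [a, b, c, d]"
  by (auto simp: card_insert_if split: if_splits)

lemma tetrahedron_vertices:
  assumes "3 simplex S"
  obtains a b c d where "S = convex hull {a, b, c, d}"
    and "\<not> affine_dependent {a, b, c, d}" and "card {a, b, c, d} = 4"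
proof -
  obtain V where V: "\<not> affine_dependent V" "card V = 4" "S = convex hull V"
    using assms by (auto simp: simplex_def)
  moreover obtain a b c d where "V = {a, b, c, d}"
    using V(2) by (auto simp: card_Suc_eq numeral_eq_Suc)
  ultimately show thesis
    using that by metis
qed

lemma barycenters_tetrahedron:
  assumes ind: "\<not> affine_dependent {a, b, c, d :: real^3}" and card: "card {a, b, c, d} = 4"
  shows "barycenter (convex hull {a, b, c, d}) = (1/4) *\<^sub>R (a + b + c + d)"
    and "barycenter (convex hull {b, c, d}) = (1/3) *\<^sub>R (b + c + d)"
    and "barycenter (convex hull {a, b}) = (1/2) *\<^sub>R (a + b)"
proof -
  have "\<not> affine_dependent {b, c, d}" "\<not> affine_dependent {a, b}"
    by (rule affine_independent_subset[OF ind]; blast)+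
  then show "barycenter (convex hull {a, b, c, d}) = (1/4) *\<^sub>R (a + b + c + d)"
    "barycenter (convex hull {b, c, d}) = (1/3) *\<^sub>R (b + c + d)"
    "barycenter (convex hull {a, b}) = (1/2) *\<^sub>R (a + b)"
    using card_4_distinct[OF card] ind by (simp_all add: barycenter_simplex add.assoc)
qed

lemma faces_tetrahedron:
  assumes "\<not> affine_dependent V" "card V = 4"
  shows "faces (convex hull V) = (\<lambda>v. convex hull (V - {v})) ` V"
  using assms by (auto simp: faces_def facet_of_convex_hull_affine_independent_alt)

text \<open>The generating set is recovered as the set of extreme points. Hence sums over faces or
  edges can be reindexed by vertex sets.\<close>

lemma inj_on_convex_hull_Pow:
  assumes "\<not> affine_dependent (V :: 'a::euclidean_space set)"
  shows "inj_on (\<lambda>X. convex hull X) (Pow V)"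
proof (rule inj_onI)
  fix X Y assume "X \<in> Pow V" "Y \<in> Pow V" "convex hull X = convex hull Y"
  moreover from this have "\<not> affine_dependent X" "\<not> affine_dependent Y"
    using affine_independent_subset[OF assms] by auto
  ultimately show "X = Y"
    by (metis extreme_point_of_convex_hull_affine_independent subsetI subset_antisym)
qed

lemma edges_tetrahedron:
  assumes "\<not> affine_dependent V"
  shows "edges (convex hull V) = (\<lambda>P. convex hull P) ` {P. P \<subseteq> V \<and> card P = 2}"
proof -
  have "aff_dim (convex hull P) = 1 \<longleftrightarrow> card P = 2" if "P \<subseteq> V" for P
    using aff_dim_affine_independent[OF affine_independent_subset[OF assms that]]
    by (simp add: aff_dim_convex_hull) linarith
  then show ?thesis
    by (auto simp: edges_def edge_of_def face_of_convex_hull_affine_independent[OF assms])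
qed

text \<open>Each triple is written so that the opposite vertex followed by the triple is an even
  permutation of \<open>a, b, c, d\<close>.\<close>

lemma sum_faces_tetrahedron:
  fixes g :: "(real^3) set \<Rightarrow> 'b::comm_monoid_add"
  assumes ind: "\<not> affine_dependent {a, b, c, d}" and card: "card {a, b, c, d} = 4"
  shows "(\<Sum>f\<in>faces (convex hull {a, b, c, d}). g f) =
     g (convex hull {b, c, d}) + g (convex hull {a, d, c})
     + g (convex hull {d, a, b}) + g (convex hull {c, b, a})"
proof -
  let ?V = "{a, b, c, d}"
  note dist = card_4_distinct[OF card]
  have inj: "inj_on (\<lambda>v. convex hull (?V - {v})) ?V"
  proof (rule inj_onI)
    fix v w assume vw: "v \<in> ?V" "w \<in> ?V" "convex hull (?V - {v}) = convex hull (?V - {w})"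
    have "?V - {v} = ?V - {w}"
      by (rule inj_onD[OF inj_on_convex_hull_Pow[OF ind] vw(3)]) auto
    with vw show "v = w" by blast
  qed
  have "?V - {a} = {b, c, d}" "?V - {b} = {a, d, c}" "?V - {c} = {d, a, b}" "?V - {d} = {c, b, a}"
    using dist by auto
  then show ?thesis
    using dist unfolding faces_tetrahedron[OF ind card] sum.reindex[OF inj]
    by (simp add: add.assoc)
qed

text \<open>The pairs are the first two entries of the labellings in \<open>edge_identity\<close>,
  in the same order.\<close>

lemma sum_edges_tetrahedron:
  fixes g :: "(real^3) set \<Rightarrow> 'b::comm_monoid_add"
  assumes ind: "\<not> affine_dependent {a, b, c, d}" and card: "card {a, b, c, d} = 4"
  shows "(\<Sum>e\<in>edges (convex hull {a, b, c, d}). g e) =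
     g (convex hull {a, b}) + g (convex hull {a, c}) + g (convex hull {a, d})
     + g (convex hull {b, c}) + g (convex hull {c, d}) + g (convex hull {b, d})"
proof -
  let ?V = "{a, b, c, d}"
  let ?P = "{{a, b}, {a, c}, {a, d}, {b, c}, {c, d}, {b, d}}"
  note dist = card_4_distinct[OF card]
  have eq: "{P. P \<subseteq> ?V \<and> card P = 2} = ?P"
  proof (intro equalityI subsetI)
    fix P assume "P \<in> {P. P \<subseteq> ?V \<and> card P = 2}"
    then obtain x y where "P = {x, y}" "x \<noteq> y" "x \<in> ?V" "y \<in> ?V"
      by (auto simp: card_2_iff)
    then show "P \<in> ?P"
      by (elim insertE emptyE) (simp_all add: insert_commute)
  qed (use dist in auto)
  have inj: "inj_on (\<lambda>X. convex hull X) ?P"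
    by (rule inj_on_subset[OF inj_on_convex_hull_Pow[OF ind]]) auto
  show ?thesis
    using dist unfolding edges_tetrahedron[OF ind] eq sum.reindex[OF inj]
    by (auto simp: doubleton_eq_iff add.assoc)
qed

section \<open>Contributions of single faces and edges\<close>

text \<open>Keeping the set \<open>V\<close> apart from its labelling lets the lemma be applied to
  several labellings of one tetrahedron.\<close>

lemma face_contribution:
  assumes ind: "\<not> affine_dependent V" and card: "card V = 4" and V: "V = {a, b, c, d}"
    and \<nu>: "face_orientation (convex hull V) \<nu>"
  defines "f \<equiv> convex hull {b, c, d}"
  shows "(face_vec \<nu> f \<bullet> u) *\<^sub>R dual_edge_vec (convex hull V) \<nu> f =
    (sgn (tetra_det a b c d) / 8 * (cross3 (c - b) (d - b) \<bullet> u)) *\<^sub>R ((1/3) *\<^sub>R (b + c + d) - a)"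
proof -
  note ind = ind[unfolded V] and card = card[unfolded V] and \<nu> = \<nu>[unfolded V]
  let ?c = "convex hull {a, b, c, d}"
  let ?N = "(1/2) *\<^sub>R cross3 (c - b) (d - b)"
  let ?p = "barycenter f - barycenter ?c"
  note dist = card_4_distinct[OF card]
  have ind': "\<not> affine_dependent {b, c, d}"
    by (rule affine_independent_subset[OF ind]) blast
  have area: "area f = norm (cross3 (c - b) (d - b)) / 2"
    unfolding f_def by (rule area_triangle[OF ind']) (use dist in simp)
  have "f = convex hull ({a, b, c, d} - {a})"
    using dist by (auto simp: f_def)
  then have "f \<in> faces ?c"
    by (simp add: faces_tetrahedron[OF ind card])
  moreover have "b \<in> f" "c \<in> f" "d \<in> f"
    by (auto simp: f_def hull_inc)
  ultimately have "norm (\<nu> f) = 1" "\<nu> f \<bullet> (c - b) = 0" "\<nu> f \<bullet> (d - b) = 0"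
    using \<nu> unfolding face_orientation_def by blast+
  note normal = unit_normal_cross3[OF this]
  have "face_vec \<nu> f = (1/2) *\<^sub>R (norm (cross3 (c - b) (d - b)) *\<^sub>R \<nu> f)"
    by (simp add: face_vec_def area)
  with normal have F: "face_vec \<nu> f = ?N \<or> face_vec \<nu> f = - ?N"
    by (elim disjE) (simp_all only: scaleR_minus_right simp_thms)
  \<comment> \<open>The barycenter of the tetrahedron lies three quarters of the way from
    \<open>a\<close> to that of the opposite face.\<close>
  have p: "?p = (1/4) *\<^sub>R ((1/3) *\<^sub>R (b + c + d) - a)"
    by (simp add: f_def barycenters_tetrahedron[OF ind card] vec_eq_iff field_simps)
  \<comment> \<open>The face barycenter may be replaced by \<open>b\<close>, as their difference is
    orthogonal to the normal. The factor 1/8 is 1/4 from \<open>?p\<close> times 1/2 from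
    \<open>?N\<close>.\<close>
  have pN: "?p \<bullet> ?N = tetra_det a b c d / 8"
    unfolding p by (simp add: tetra_det_def cross3_def inner_vec_def sum_3) (simp add: field_simps)
  have nz: "?p \<bullet> ?N \<noteq> 0"
    unfolding pN using tetra_det_nonzero[OF ind card] by simp
  show ?thesis
    unfolding V dual_edge_vec_def scaleR_the_positive_choice[OF F nz] pN
    unfolding p by (simp add: sgn_divide)
qed

lemma face_identity:
  "(\<Sum>(a, b, c, d)\<leftarrow>[(a, b, c, d), (b, a, d, c), (c, d, a, b), (d, c, b, a)].
      (cross3 (c - b) (d - b) \<bullet> u) *\<^sub>R ((1/3) *\<^sub>R (b + c + d) - a)) = (4/3 * tetra_det a b c d) *\<^sub>R u"
proof -
  \<comment> \<open>Both sides depend on differences of vertices only, so \<open>a\<close> serves as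
    origin; a polynomial identity in the coordinates remains.\<close>
  define x y z where "x = b - a" "y = c - a" "z = d - a"
  then have "b = a + x" "c = a + y" "d = a + z" by auto
  then show ?thesis
    by (simp add: tetra_det_def cross3_def inner_vec_def sum_3 vec_eq_iff forall_3) (simp add: field_simps)
qed

text \<open>These are the nontrivial labellings in \<open>face_identity\<close> and
  \<open>edge_identity\<close>; they give all terms the same sign.\<close>

lemma tetra_det_even_permutations:
  "tetra_det b a d c = tetra_det a b c d"
  "tetra_det c d a b = tetra_det a b c d"
  "tetra_det d c b a = tetra_det a b c d"
  "tetra_det a c d b = tetra_det a b c d"
  "tetra_det a d b c = tetra_det a b c d"
  "tetra_det b c a d = tetra_det a b c d"
  "tetra_det b d c a = tetra_det a b c d"
  by (simp_all add: tetra_det_def cross3_def inner_vec_def sum_3 algebra_simps)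

text \<open>Each face omits one vertex, and by affine independence two faces meet in the hull of
  their common vertices. So the faces meeting in an edge omit one each of the two vertices off that
  edge, and only their order is free in \<open>dual_face_vec\<close>.\<close>

lemma faces_meeting_in_edge:
  assumes ind: "\<not> affine_dependent {a, b, c, d}" and card: "card {a, b, c, d} = 4"
  shows "(f \<in> faces (convex hull {a, b, c, d}) \<and> g \<in> faces (convex hull {a, b, c, d})
      \<and> convex hull {a, b} = f \<inter> g) \<longleftrightarrow>
    (f = convex hull {a, b, d} \<and> g = convex hull {a, b, c}) \<or>
    (f = convex hull {a, b, c} \<and> g = convex hull {a, b, d})"
proof -
  let ?V = "{a, b, c, d}"
  note dist = card_4_distinct[OF card]
  have Vcd: "convex hull {a, b, d} = convex hull (?V - {c})"
    "convex hull {a, b, c} = convex hull (?V - {d})"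
    using dist by (auto intro!: arg_cong[of _ _ "\<lambda>X. convex hull X"])
  have meet: "convex hull {a, b} = convex hull (?V - {x}) \<inter> convex hull (?V - {y}) \<longleftrightarrow>
      (x = c \<and> y = d) \<or> (x = d \<and> y = c)" if "x \<in> ?V" "y \<in> ?V" for x y
  proof -
    have "\<not> affine_dependent ((?V - {x}) \<union> (?V - {y}))"
      by (rule affine_independent_subset[OF ind]) blast
    note hull_Int = convex_hull_Int[OF this]
    have inter: "?V - {x, y} = (?V - {x}) \<inter> (?V - {y})"
      by blast
    have "convex hull (?V - {x}) \<inter> convex hull (?V - {y}) = convex hull (?V - {x, y})"
      unfolding inter hull_Int ..
    moreover have "convex hull {a, b} = convex hull (?V - {x, y}) \<longleftrightarrow> {a, b} = ?V - {x, y}"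
      by (rule inj_on_eq_iff[OF inj_on_convex_hull_Pow[OF ind]]) auto
    moreover have "{a, b} = ?V - {x, y} \<longleftrightarrow> (x = c \<and> y = d) \<or> (x = d \<and> y = c)"
    proof
      assume eq: "{a, b} = ?V - {x, y}"
      have "c \<notin> ?V - {x, y}" "d \<notin> ?V - {x, y}"
        unfolding eq[symmetric] using dist by auto
      then have "c = x \<or> c = y" "d = x \<or> d = y"
        by simp_all
      then show "(x = c \<and> y = d) \<or> (x = d \<and> y = c)"
        using dist by auto
    next
      assume "(x = c \<and> y = d) \<or> (x = d \<and> y = c)"
      then show "{a, b} = ?V - {x, y}"
        using dist by (elim disjE conjE) auto
    qed
    ultimately show ?thesis by simp
  qed
  show ?thesis
  proof
    assume *: "f \<in> faces (convex hull ?V) \<and> g \<in> faces (convex hull ?V) \<and> convex hull {a, b} = f \<inter> g"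
    then obtain x y where xy: "x \<in> ?V" "y \<in> ?V" "f = convex hull (?V - {x})" "g = convex hull (?V - {y})"
      unfolding faces_tetrahedron[OF ind card] by (elim conjE imageE) blast
    with * meet[OF xy(1,2)] have "(x = c \<and> y = d) \<or> (x = d \<and> y = c)"
      by simp
    with xy show "(f = convex hull {a, b, d} \<and> g = convex hull {a, b, c}) \<or>
      (f = convex hull {a, b, c} \<and> g = convex hull {a, b, d})"
      unfolding Vcd by blast
  next
    assume "(f = convex hull {a, b, d} \<and> g = convex hull {a, b, c}) \<or>
      (f = convex hull {a, b, c} \<and> g = convex hull {a, b, d})"
    then show "f \<in> faces (convex hull ?V) \<and> g \<in> faces (convex hull ?V) \<and> convex hull {a, b} = f \<inter> g"
      unfolding Vcd faces_tetrahedron[OF ind card] using meet[of c d] meet[of d c] by blast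
  qed
qed

lemma edge_contribution:
  assumes ind: "\<not> affine_dependent V" and card: "card V = 4" and V: "V = {a, b, c, d}"
    and \<tau>: "edge_orientation (convex hull V) \<tau>"
  defines "e \<equiv> convex hull {a, b}"
  shows "(edge_vec \<tau> e \<bullet> u) *\<^sub>R dual_face_vec (convex hull V) \<tau> e =
    (sgn (tetra_det a b c d) / 24 * ((b - a) \<bullet> u)) *\<^sub>R cross3 (d - c) (a + b - c - d)"
proof -
  note ind = ind[unfolded V] and card = card[unfolded V] and \<tau> = \<tau>[unfolded V]
  let ?c = "convex hull {a, b, c, d}"
  let ?t = "(1/24) *\<^sub>R cross3 (d - c) (a + b - c - d)"
  let ?q = "barycenter ?c"
  let ?w = "\<lambda>f g. (1/2) *\<^sub>R (cross3 (barycenter f - ?q) (barycenter e - ?q)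
                              - cross3 (barycenter g - ?q) (barycenter e - ?q))"
  note dist = card_4_distinct[OF card]
  have "e \<in> edges ?c"
    using dist by (auto simp: e_def edges_tetrahedron[OF ind])
  then have "closed_segment a b = closed_segment (fst (\<tau> e)) (snd (\<tau> e))"
    using \<tau> by (simp add: edge_orientation_def e_def segment_convex_hull)
  then have F: "edge_vec \<tau> e = b - a \<or> edge_vec \<tau> e = - (b - a)"
    by (auto simp: edge_vec_def closed_segment_eq doubleton_eq_iff)
  have "\<not> affine_dependent {a, b, c}" "\<not> affine_dependent {a, b, d}"
    by (rule affine_independent_subset[OF ind]; blast)+
  \<comment> \<open>The two cross products share their second factor, so only this difference
    matters. The factor 1/24 in \<open>?t\<close> is the product of 1/2, 1/3 and 1/4.\<close>
  then have "barycenter (convex hull {a, b, d}) - barycenter (convex hull {a, b, c}) = (1/3) *\<^sub>R (d - c)"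
    using dist by (simp add: barycenter_simplex algebra_simps)
  moreover have "barycenter e - ?q = (1/4) *\<^sub>R (a + b - c - d)"
    by (simp add: e_def barycenters_tetrahedron[OF ind card] vec_eq_iff field_simps)
  ultimately have w: "?w (convex hull {a, b, d}) (convex hull {a, b, c}) = ?t"
    unfolding Cross3.left_diff_distrib[symmetric]
    by (simp add: cross_mult_left cross_mult_right diff_diff_eq2)
  \<comment> \<open>Swapping the two faces changes the sign, so the candidates have the form
    required by \<open>scaleR_the_positive_choice\<close>.\<close>
  have w': "?w (convex hull {a, b, c}) (convex hull {a, b, d}) = - ?t"
    unfolding w[symmetric] scaleR_minus_right[symmetric] minus_diff_eq ..
  have choice: "(\<exists>f\<in>faces ?c. \<exists>g\<in>faces ?c. e = f \<inter> g \<and> v = ?w f g) \<longleftrightarrow> v = ?t \<or> v = - ?t" for v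
  proof -
    have pair: "(\<exists>f g. (f = X \<and> g = Y \<or> f = Y \<and> g = X) \<and> P f g) \<longleftrightarrow> P X Y \<or> P Y X"
      for X Y :: "(real^3) set" and P
      by auto
    have "(\<exists>f\<in>faces ?c. \<exists>g\<in>faces ?c. e = f \<inter> g \<and> v = ?w f g) \<longleftrightarrow>
      (\<exists>f g. (f \<in> faces ?c \<and> g \<in> faces ?c \<and> e = f \<inter> g) \<and> v = ?w f g)"
      by blast
    also have "\<dots> \<longleftrightarrow> v = ?w (convex hull {a, b, d}) (convex hull {a, b, c})
        \<or> v = ?w (convex hull {a, b, c}) (convex hull {a, b, d})"
      unfolding faces_meeting_in_edge[OF ind card, folded e_def] by (rule pair)
    finally show ?thesis
      unfolding w w' .
  qed
  \<comment> \<open>With \<open>a\<close> as origin, the triple product expands to two equal copies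
    of the determinant, and 2/24 is 1/12.\<close>
  have pN: "?t \<bullet> (b - a) = tetra_det a b c d / 12"
    by (simp add: tetra_det_def cross3_def inner_vec_def sum_3) (simp add: field_simps)
  have nz: "?t \<bullet> (b - a) \<noteq> 0"
    unfolding pN using tetra_det_nonzero[OF ind card] by simp
  show ?thesis
    unfolding V dual_face_vec_def choice scaleR_the_positive_choice[OF F nz] pN
    by (simp add: sgn_divide)
qed

lemma edge_identity:
  "(\<Sum>(a, b, c, d)\<leftarrow>[(a, b, c, d), (a, c, d, b), (a, d, b, c), (b, c, a, d), (c, d, a, b), (b, d, c, a)].
      ((b - a) \<bullet> u) *\<^sub>R cross3 (d - c) (a + b - c - d)) = (4 * tetra_det a b c d) *\<^sub>R u"
proof -
  define x y z where "x = b - a" "y = c - a" "z = d - a"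
  then have "b = a + x" "c = a + y" "d = a + z" by auto
  then show ?thesis
    by (simp add: tetra_det_def cross3_def inner_vec_def sum_3 vec_eq_iff forall_3) (simp add: field_simps)
qed

section \<open>Summation over all faces and all edges\<close>

lemma transpose_dual_mult_face_mat:
  fixes \<phi> :: "'f::finite \<Rightarrow> (real^3) set"
  assumes "3 simplex c" "face_orientation c \<nu>" "bij_betw \<phi> UNIV (faces c)"
  shows "transpose (dual_edge_mat c \<nu> \<phi>) *v (face_mat \<nu> \<phi> *v u) = measure lebesgue c *\<^sub>R u"
proof -
  obtain p q r s where c: "c = convex hull {p, q, r, s}"
    and ind: "\<not> affine_dependent {p, q, r, s}" and card: "card {p, q, r, s} = 4"
    by (rule tetrahedron_vertices[OF assms(1)])
  note contribution = face_contribution[OF ind card _ assms(2)[unfolded c]]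
  have perm: "{p, q, r, s} = {q, p, s, r}" "{p, q, r, s} = {r, s, p, q}" "{p, q, r, s} = {s, r, q, p}"
    by auto
  let ?D = "tetra_det p q r s"
  have "transpose (dual_edge_mat c \<nu> \<phi>) *v (face_mat \<nu> \<phi> *v u)
      = (\<Sum>f\<in>faces c. (face_vec \<nu> f \<bullet> u) *\<^sub>R dual_edge_vec c \<nu> f)"
    unfolding dual_edge_mat_def face_mat_def transpose_mat_of_rows_mult
    by (rule sum.reindex_bij_betw[OF assms(3)])
  \<comment> \<open>The labellings are even, so every term carries the sign of \<open>?D\<close>,
    which can be factored out.\<close>
  also have "\<dots> = (sgn ?D / 8) *\<^sub>R (\<Sum>(a, b, c, d)\<leftarrow>[(p, q, r, s), (q, p, s, r), (r, s, p, q), (s, r, q, p)].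
      (cross3 (c - b) (d - b) \<bullet> u) *\<^sub>R ((1/3) *\<^sub>R (b + c + d) - a))"
    unfolding c sum_faces_tetrahedron[OF ind card]
      contribution[OF refl] contribution[OF perm(1)] contribution[OF perm(2)] contribution[OF perm(3)]
      tetra_det_even_permutations[where a = p and b = q and c = r and d = s]
    by (simp add: scaleR_add_right)
  also have "\<dots> = (sgn ?D / 8 * (4/3 * ?D)) *\<^sub>R u"
    unfolding face_identity by simp
  \<comment> \<open>The sign makes \<open>?D\<close> positive, and the constants multiply to 1/6,
    the factor in the volume formula.\<close>
  also have "sgn ?D / 8 * (4/3 * ?D) = measure lebesgue c"
    by (simp add: c volume_tetrahedron[OF card] abs_sgn)
  finally show ?thesis .
qed

lemma transpose_dual_mult_edge_mat:
  fixes \<epsilon> :: "'e::finite \<Rightarrow> (real^3) set"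
  assumes "3 simplex c" "edge_orientation c \<tau>" "bij_betw \<epsilon> UNIV (edges c)"
  shows "transpose (dual_face_mat c \<tau> \<epsilon>) *v (edge_mat \<tau> \<epsilon> *v u) = measure lebesgue c *\<^sub>R u"
proof -
  obtain p q r s where c: "c = convex hull {p, q, r, s}"
    and ind: "\<not> affine_dependent {p, q, r, s}" and card: "card {p, q, r, s} = 4"
    by (rule tetrahedron_vertices[OF assms(1)])
  note contribution = edge_contribution[OF ind card _ assms(2)[unfolded c]]
  have perm: "{p, q, r, s} = {p, r, s, q}" "{p, q, r, s} = {p, s, q, r}" "{p, q, r, s} = {q, r, p, s}"
    "{p, q, r, s} = {r, s, p, q}" "{p, q, r, s} = {q, s, r, p}"
    by auto
  let ?D = "tetra_det p q r s"
  have "transpose (dual_face_mat c \<tau> \<epsilon>) *v (edge_mat \<tau> \<epsilon> *v u)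
      = (\<Sum>e\<in>edges c. (edge_vec \<tau> e \<bullet> u) *\<^sub>R dual_face_vec c \<tau> e)"
    unfolding dual_face_mat_def edge_mat_def transpose_mat_of_rows_mult
    by (rule sum.reindex_bij_betw[OF assms(3)])
  also have "\<dots> = (sgn ?D / 24) *\<^sub>R (\<Sum>(a, b, c, d)\<leftarrow>
      [(p, q, r, s), (p, r, s, q), (p, s, q, r), (q, r, p, s), (r, s, p, q), (q, s, r, p)].
      ((b - a) \<bullet> u) *\<^sub>R cross3 (d - c) (a + b - c - d))"
    unfolding c sum_edges_tetrahedron[OF ind card]
      contribution[OF refl] contribution[OF perm(1)] contribution[OF perm(2)] contribution[OF perm(3)]
      contribution[OF perm(4)] contribution[OF perm(5)] tetra_det_even_permutations[where a = p and b = q and c = r and d = s]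
    by (simp add: scaleR_add_right)
  also have "\<dots> = (sgn ?D / 24 * (4 * ?D)) *\<^sub>R u"
    unfolding edge_identity by simp
  \<comment> \<open>Again the constants give 1/6, now as 4/24.\<close>
  also have "sgn ?D / 24 * (4 * ?D) = measure lebesgue c"
    by (simp add: c volume_tetrahedron[OF card] abs_sgn)
  finally show ?thesis .
qed

theorem lemma2:
  fixes c :: "(real^3) set"
    and \<tau> :: "(real^3) set \<Rightarrow> (real^3) \<times> (real^3)"
    and \<nu> :: "(real^3) set \<Rightarrow> real^3"
    and \<phi> :: "'f::finite \<Rightarrow> (real^3) set"
    and \<epsilon> :: "'e::finite \<Rightarrow> (real^3) set"
    and K :: "real^3^3"
    and \<alpha>F :: "real^'k::finite"
    and \<alpha>E :: "real^'l::finite"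
    and wF :: "'k \<Rightarrow> real^'f"
    and wE :: "'l \<Rightarrow> real^'e"
  assumes "3 simplex c"
    and "edge_orientation c \<tau>"
    and "face_orientation c \<nu>"
    and "bij_betw \<phi> UNIV (faces c)"
    and "bij_betw \<epsilon> UNIV (edges c)"
    and "symmetric_mat K" and "pos_definite K"
    and "CARD('k) = card (faces c) - 3"
    and "CARD('l) = card (edges c) - 3"
    and "\<forall>i. \<alpha>F $ i > 0"
    and "\<forall>i. \<alpha>E $ i > 0"
    and "orthonormal_basis_of (orthogonal_comp (range (\<lambda>u. face_mat \<nu> \<phi> *v u))) wF"
    and "orthonormal_basis_of (orthogonal_comp (range (\<lambda>u. edge_mat \<tau> \<epsilon> *v u))) wE"
  defines "MF \<equiv> mass_mat c K (dual_edge_mat c \<nu> \<phi>) (mat_of_columns wF) \<alpha>F"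
    and "ME \<equiv> mass_mat c K (dual_face_mat c \<tau> \<epsilon>) (mat_of_columns wE) \<alpha>E"
  shows "(symmetric_mat MF \<and> consistent K (face_mat \<nu> \<phi>) (dual_edge_mat c \<nu> \<phi>) MF \<and> pos_definite MF) \<and>
         (symmetric_mat ME \<and> consistent K (edge_mat \<tau> \<epsilon>) (dual_face_mat c \<tau> \<epsilon>) ME \<and> pos_definite ME)"
proof -
  have vol: "measure lebesgue c > 0"
    using \<open>3 simplex c\<close> by (rule tetrahedron_vertices) (simp add: volume_tetrahedron_pos)
  note dual_primal = transpose_dual_mult_face_mat[OF assms(1,3,4)] transpose_dual_mult_edge_mat[OF assms(1,2,5)]
  show ?thesis
    unfolding MF_def ME_def
    by (rule conjI mass_mat_properties vol dual_primal assms(6,7,10-13))+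
qed

end
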